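(* Let $k\ge 0$ be an integer. For each dimension $d\ge 1$ let $C_1(k,d)$ be the sharp (i.e. largest possible) constant $C$ such that $$\sum_{n\in\mathbb{Z}^d}|D(\Delta^k u)(n)|^2\;\ge\;C\sum_{n\in\mathbb{Z}^d}\frac{|u(n)|^2}{|n|^{4k+2}}$$ holds for all finitely supported functions $u$ on $\mathbb{Z}^d$ with $u(0)=0$. Then $C_1(k,d)\sim d^{2k+1}$ as $d\to\infty$; that is, there exist positive constants $c_1,c_2$ and $N$, independent of $d$, such that $$c_1 d^{2k+1}\le C_1(k,d)\le c_2 d^{2k+1}\qquad\text{for all } d\ge N.$$
   Context: Functions on $\mathbb{Z}^d$ are complex-valued; $|n|$ is the Euclidean norm of $n\in\mathbb{Z}^d$; $e_1,\dots,e_d$ is the canonical basis of $\mathbb{R}^d$. $D_ju(n):=u(n)-u(n-e_j)$, $Du(n):=(D_1u(n),\dots,D_du(n))$, so $|Du(n)|^2=\sum_{j=1}^d|D_ju(n)|^2$, and $\Delta u(n):=\sum_{j=1}^d\big(2u(n)-u(n-e_j)-u(n+e_j)\big)$; $\Delta^k$ is the $k$-fold iterate ($\Delta^0$ the identity). In the right-hand sum the $n=0$ term is understood to be $0$ (as $u(0)=0$). *)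

theory Defs
  imports "HOL-Analysis.Analysis"
begin

text \<open>
  The dimension is quantified inside the statement, so the lattice cannot be indexed by a type:
  \<open>\<int>\<^sup>d\<close> is the set of integer sequences vanishing from index \<open>d\<close> on, with coordinates
  numbered \<open>0, \<dots>, d - 1\<close>. A function on \<open>\<int>\<^sup>d\<close> is a function on all sequences whose values off
  the lattice are irrelevant; the difference operators below only shift coordinates \<open>j < d\<close> and
  hence never leave the lattice.
\<close>

definition lattice :: "nat \<Rightarrow> (nat \<Rightarrow> int) set" where
  "lattice d = {n. \<forall>i\<ge>d. n i = 0}"

definition lattice_norm :: "nat \<Rightarrow> (nat \<Rightarrow> int) \<Rightarrow> real" where
  "lattice_norm d n = L2_set (\<lambda>i. real_of_int (n i)) {..<d}"

definition backward_diff :: "nat \<Rightarrow> ((nat \<Rightarrow> int) \<Rightarrow> complex) \<Rightarrow> (nat \<Rightarrow> int) \<Rightarrow> complex" where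
  "backward_diff j u n = u n - u (n(j := n j - 1))"

definition grad_norm_sq :: "nat \<Rightarrow> ((nat \<Rightarrow> int) \<Rightarrow> complex) \<Rightarrow> (nat \<Rightarrow> int) \<Rightarrow> real" where
  "grad_norm_sq d u n = (\<Sum>j<d. (cmod (backward_diff j u n))\<^sup>2)"

definition laplacian :: "nat \<Rightarrow> ((nat \<Rightarrow> int) \<Rightarrow> complex) \<Rightarrow> (nat \<Rightarrow> int) \<Rightarrow> complex" where
  "laplacian d u n = (\<Sum>j<d. 2 * u n - u (n(j := n j - 1)) - u (n(j := n j + 1)))"

definition finitely_supported :: "nat \<Rightarrow> ((nat \<Rightarrow> int) \<Rightarrow> complex) \<Rightarrow> bool" where
  "finitely_supported d u \<longleftrightarrow> finite {n \<in> lattice d. u n \<noteq> 0}"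

text \<open>
  Both sums have finitely many nonzero terms. The term of the right-hand sum at the origin is
  \<open>0 / 0 = 0\<close>.
\<close>

definition hardy_rellich_ineq :: "nat \<Rightarrow> nat \<Rightarrow> real \<Rightarrow> bool" where
  "hardy_rellich_ineq k d C \<longleftrightarrow>
     (\<forall>u. finitely_supported d u \<and> u (\<lambda>_. 0) = 0 \<longrightarrow>
        (\<Sum>\<^sub>\<infinity>n\<in>lattice d. grad_norm_sq d ((laplacian d ^^ k) u) n)
          \<ge> C * (\<Sum>\<^sub>\<infinity>n\<in>lattice d. (cmod (u n))\<^sup>2 / lattice_norm d n ^ (4 * k + 2)))"

definition sharp_constant :: "nat \<Rightarrow> nat \<Rightarrow> real" where
  "sharp_constant k d = (GREATEST C. hardy_rellich_ineq k d C)"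

text \<open>For \<open>d \<ge> 1\<close> the largest constant exists, so \<^const>\<open>sharp_constant\<close> is well defined.\<close>

lemma sharp_constant_greatest:
  assumes "d \<ge> 1"
  shows "hardy_rellich_ineq k d (sharp_constant k d)"
    and "hardy_rellich_ineq k d C \<Longrightarrow> C \<le> sharp_constant k d"
proof -
  define L where "L = (\<lambda>u. \<Sum>\<^sub>\<infinity>n\<in>lattice d. grad_norm_sq d ((laplacian d ^^ k) u) n)"
  define R where "R = (\<lambda>u::(nat \<Rightarrow> int) \<Rightarrow> complex.
    \<Sum>\<^sub>\<infinity>n\<in>lattice d. (cmod (u n))\<^sup>2 / lattice_norm d n ^ (4 * k + 2))"
  define S where "S = Collect (hardy_rellich_ineq k d)"
  have ineq: "hardy_rellich_ineq k d C \<longleftrightarrow>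
      (\<forall>u. finitely_supported d u \<and> u (\<lambda>_. 0) = 0 \<longrightarrow> C * R u \<le> L u)" for C
    unfolding hardy_rellich_ineq_def L_def R_def ..
  have L0: "L u \<ge> 0" for u
    unfolding L_def grad_norm_sq_def by (intro infsum_nonneg sum_nonneg) auto
  have R0: "R u \<ge> 0" for u
    unfolding R_def lattice_norm_def by (intro infsum_nonneg divide_nonneg_nonneg) auto
  have "0 \<in> S" using L0 by (simp add: S_def ineq)
  define e :: "nat \<Rightarrow> int" where "e = (\<lambda>i. if i = 0 then 1 else 0)"
  define v :: "(nat \<Rightarrow> int) \<Rightarrow> complex" where "v = (\<lambda>n. if n = e then 1 else 0)"
  have e: "e \<in> lattice d" using assms by (auto simp: e_def lattice_def)
  have "e \<noteq> (\<lambda>_. 0)" by (auto simp: e_def fun_eq_iff)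
  then have v0: "v (\<lambda>_. 0) = 0" by (auto simp: v_def)
  have vfin: "finitely_supported d v"
    unfolding finitely_supported_def by (rule finite_subset[of _ "{e}"]) (auto simp: v_def)
  have "(\<Sum>i<d. (real_of_int (e i))\<^sup>2) = (\<Sum>i<d. if i = 0 then 1 else 0)"
    by (rule sum.cong) (auto simp: e_def)
  then have ne: "lattice_norm d e = 1"
    using assms by (simp add: lattice_norm_def L2_set_def)
  have "R v = (\<Sum>\<^sub>\<infinity>n\<in>{e}. (cmod (v n))\<^sup>2 / lattice_norm d n ^ (4 * k + 2))"
    unfolding R_def by (rule infsum_cong_neutral) (use e in \<open>auto simp: v_def\<close>)
  then have Rv: "R v = 1" by (simp add: v_def ne)
  have bdd: "bdd_above S"
  proof (rule bdd_aboveI)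
    fix C assume "C \<in> S"
    then have "C * R v \<le> L v" using v0 vfin by (auto simp: S_def ineq)
    then show "C \<le> L v" by (simp add: Rv)
  qed
  have "hardy_rellich_ineq k d (Sup S)"
    unfolding ineq
  proof (intro allI impI)
    fix u assume u: "finitely_supported d u \<and> u (\<lambda>_. 0) = 0"
    show "Sup S * R u \<le> L u"
    proof (cases "R u = 0")
      case True
      then show ?thesis using L0 by simp
    next
      case False
      with R0[of u] have pos: "R u > 0" by simp
      have "Sup S \<le> L u / R u"
      proof (rule cSup_least)
        show "S \<noteq> {}" using \<open>0 \<in> S\<close> by auto
        fix C assume "C \<in> S"
        then show "C \<le> L u / R u" using u pos by (auto simp: S_def ineq pos_le_divide_eq)
      qed
      then show ?thesis using pos by (simp add: pos_le_divide_eq)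
    qed
  qed
  moreover have up: "C \<le> Sup S" if "hardy_rellich_ineq k d C" for C
    using that bdd by (auto simp: S_def intro: cSup_upper)
  ultimately have "sharp_constant k d = Sup S \<and> hardy_rellich_ineq k d (Sup S)"
    unfolding sharp_constant_def by (auto intro: Greatest_equality)
  with up show "hardy_rellich_ineq k d (sharp_constant k d)"
    and "hardy_rellich_ineq k d C \<Longrightarrow> C \<le> sharp_constant k d" by auto
qed

end

theory Submission imports Defs "HOL-Computational_Algebra.Polynomial" begin

text \<open>
  Write \<open>P\<close> for the average over the \<open>2d\<close> neighbours, so that \<open>\<Delta> = 2d (1 - P)\<close>, and put
  \<open>m = 2k + 1\<close>. Summation by parts turns the left-hand side into \<open>\<langle>u, \<Delta>\<^sup>m u\<rangle>\<close>, and the unit mass at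
  \<open>e\<^sub>1\<close> gives the upper bound \<open>(4d)\<^sup>m\<close>.

  For the lower bound let \<open>w\<^sub>p(n) = (1 + |n|\<^sup>2)\<^sup>-\<^sup>p\<close>. Moving to a neighbour changes \<open>|n|\<^sup>2\<close> by
  \<open>1 \<plusminus> 2n\<^sub>j\<close>; the linear terms cancel in the average and the quadratic ones contribute only a
  relative error \<open>O(1 / (d (1 + |n|\<^sup>2)))\<close>, so for large \<open>d\<close> the drift \<open>1\<close> dominates and
  \<open>(1 - P) w\<^sub>p \<ge> c w\<^sub>p\<^sub>+\<^sub>1\<close> with \<open>c\<close> independent of \<open>d\<close>. The Neumann series of \<open>(1 - P)\<^sup>-\<^sup>1\<close> has
  nonnegative coefficients, so iterating gives \<open>(1 - P)\<^sup>-\<^sup>m w\<^sub>m\<^sub>+\<^sub>1 \<le> c\<^sup>-\<^sup>m w\<^sub>1 = W w\<^sub>m\<^sub>+\<^sub>1\<close> with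
  \<open>W = c\<^sup>-\<^sup>m (1 + |n|\<^sup>2)\<^sup>m\<close>. By the Schur test \<open>(1 - P)\<^sup>-\<^sup>m \<le> W\<close> as quadratic forms, and
  dually \<open>(1 - P)\<^sup>m \<ge> 1 / W\<close>. To stay within finitely supported functions, \<open>P\<close> is replaced by \<open>r P\<close> with
  \<open>r < 1\<close> and the Neumann series is truncated after \<open>L\<close> terms; then \<open>L \<rightarrow> \<infinity>\<close> and \<open>r \<rightarrow> 1\<close>.
\<close>

section \<open>Finitely supported functions on the lattice\<close>

definition shift :: "nat \<Rightarrow> int \<Rightarrow> (nat \<Rightarrow> int) \<Rightarrow> nat \<Rightarrow> int" where
  "shift j a n = n(j := n j + a)"

lemma shift_shift [simp]: "shift j a (shift j b n) = shift j (a + b) n"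
  by (simp add: shift_def add_ac)

lemma shift_0 [simp]: "shift j 0 n = n"
  by (simp add: shift_def)

lemma shift_lattice: "j < d \<Longrightarrow> n \<in> lattice d \<Longrightarrow> shift j a n \<in> lattice d"
  by (auto simp: shift_def lattice_def)

lemma bij_betw_shift: "j < d \<Longrightarrow> bij_betw (shift j a) (lattice d) (lattice d)"
  by (rule bij_betw_byWitness[where f' = "shift j (- a)"]) (auto simp: shift_lattice)

definition finsupp :: "nat \<Rightarrow> ((nat \<Rightarrow> int) \<Rightarrow> real) \<Rightarrow> bool" where
  "finsupp d f \<longleftrightarrow> finite {n \<in> lattice d. f n \<noteq> 0}"

lemma finsupp_mono:
  assumes "finsupp d f" "\<And>n. n \<in> lattice d \<Longrightarrow> f n = 0 \<Longrightarrow> g n = 0"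
  shows "finsupp d g"
  using assms unfolding finsupp_def by (auto elim!: finite_subset[rotated])

lemma finsupp_add:
  assumes "finsupp d f" "finsupp d g"
  shows "finsupp d (\<lambda>n. f n + g n)"
  unfolding finsupp_def
  by (rule finite_subset[of _ "{n \<in> lattice d. f n \<noteq> 0} \<union> {n \<in> lattice d. g n \<noteq> 0}"])
    (use assms in \<open>auto simp: finsupp_def\<close>)

lemma finsupp_diff:
  assumes "finsupp d f" "finsupp d g"
  shows "finsupp d (\<lambda>n. f n - g n)"
  unfolding finsupp_def
  by (rule finite_subset[of _ "{n \<in> lattice d. f n \<noteq> 0} \<union> {n \<in> lattice d. g n \<noteq> 0}"])
    (use assms in \<open>auto simp: finsupp_def\<close>)

lemma finsupp_sum:
  assumes "\<And>i. i \<in> I \<Longrightarrow> finsupp d (f i)"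
  shows "finsupp d (\<lambda>n. \<Sum>i\<in>I. f i n)"
  using assms
proof (induction I rule: infinite_finite_induct)
  case (insert i I)
  then show ?case by (simp add: finsupp_add)
qed (simp_all add: finsupp_def)

lemma finsupp_mult: "finsupp d f \<Longrightarrow> finsupp d (\<lambda>n. f n * g n)"
  by (erule finsupp_mono) simp

lemma finsupp_shift:
  assumes "j < d" "finsupp d f"
  shows "finsupp d (\<lambda>n. f (shift j a n))"
proof -
  have "{n \<in> lattice d. f (shift j a n) \<noteq> 0} \<subseteq> shift j (- a) ` {n \<in> lattice d. f n \<noteq> 0}"
  proof
    fix n assume n: "n \<in> {n \<in> lattice d. f (shift j a n) \<noteq> 0}"
    show "n \<in> shift j (- a) ` {n \<in> lattice d. f n \<noteq> 0}"
      by (rule image_eqI[of _ _ "shift j a n"]) (use n assms(1) in \<open>auto simp: shift_lattice\<close>)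
  qed
  then show ?thesis
    using assms(2) unfolding finsupp_def by (meson finite_imageI finite_subset)
qed

section \<open>Sums over the lattice\<close>

abbreviation lsum :: "nat \<Rightarrow> ((nat \<Rightarrow> int) \<Rightarrow> real) \<Rightarrow> real" where
  "lsum d f \<equiv> infsum f (lattice d)"

lemma finsupp_summable: "finsupp d f \<Longrightarrow> f summable_on lattice d"
  unfolding finsupp_def by (rule finite_nonzero_values_imp_summable_on) simp

lemma lsum_eq_sum:
  assumes "finite F" "F \<subseteq> lattice d" "\<And>n. n \<in> lattice d - F \<Longrightarrow> f n = 0"
  shows "lsum d f = sum f F"
  using infsum_cong_neutral[of F "lattice d" f f] assms by auto

lemma lsum_add: "finsupp d f \<Longrightarrow> finsupp d g \<Longrightarrow> lsum d (\<lambda>n. f n + g n) = lsum d f + lsum d g"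
  by (intro infsum_add finsupp_summable)

lemma lsum_diff: "finsupp d f \<Longrightarrow> finsupp d g \<Longrightarrow> lsum d (\<lambda>n. f n - g n) = lsum d f - lsum d g"
  using infsum_add[of f "lattice d" "\<lambda>n. - g n"]
  by (simp add: finsupp_summable infsum_uminus summable_on_uminus)

lemma lsum_sum:
  assumes "finite I" "\<And>i. i \<in> I \<Longrightarrow> finsupp d (f i)"
  shows "lsum d (\<lambda>n. \<Sum>i\<in>I. f i n) = (\<Sum>i\<in>I. lsum d (f i))"
  using assms
proof (induction I)
  case (insert i I)
  then show ?case
    by (simp add: lsum_add finsupp_sum)
qed simp

lemma lsum_shift: "j < d \<Longrightarrow> lsum d (\<lambda>n. f (shift j a n)) = lsum d f"
  using infsum_reindex_bij_betw[OF bij_betw_shift] .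

lemma lsum_mono:
  assumes "finsupp d f" "finsupp d g" "\<And>n. n \<in> lattice d \<Longrightarrow> f n \<le> g n"
  shows "lsum d f \<le> lsum d g"
  using assms by (intro infsum_mono finsupp_summable)

text \<open>The factor \<open>u\<close> confines every sum to one fixed finite set, so pointwise
  convergence passes to the sum without any domination.\<close>

lemma tendsto_lsum_mult:
  assumes "finsupp d u" "\<And>n. n \<in> lattice d \<Longrightarrow> ((\<lambda>x. f x n) \<longlongrightarrow> g n) F"
  shows "((\<lambda>x. lsum d (\<lambda>n. u n * f x n)) \<longlongrightarrow> lsum d (\<lambda>n. u n * g n)) F"
proof -
  define S where "S = {n \<in> lattice d. u n \<noteq> 0}"
  have "lsum d (\<lambda>n. u n * h n) = (\<Sum>n\<in>S. u n * h n)" for h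
    by (rule lsum_eq_sum) (use assms(1) in \<open>auto simp: S_def finsupp_def\<close>)
  then show ?thesis
    using assms(2) by (auto intro!: tendsto_intros simp: S_def)
qed

section \<open>Polynomials in the neighbour average\<close>

definition walk :: "nat \<Rightarrow> ((nat \<Rightarrow> int) \<Rightarrow> real) \<Rightarrow> (nat \<Rightarrow> int) \<Rightarrow> real" where
  "walk d f n = (\<Sum>j<d. f (shift j (- 1) n) + f (shift j 1 n)) / (2 * real d)"

lemma walk_linear: "walk d (\<lambda>n. a * f n + b * g n) n = a * walk d f n + b * walk d g n"
  by (simp add: walk_def sum.distrib sum_distrib_left algebra_simps add_divide_distrib)

lemma walk_nonneg: "(\<And>n. 0 \<le> f n) \<Longrightarrow> 0 \<le> walk d f n"
  unfolding walk_def by (intro divide_nonneg_nonneg sum_nonneg add_nonneg_nonneg) auto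

lemma abs_walk_le:
  assumes "\<And>n. n \<in> lattice d \<Longrightarrow> \<bar>f n\<bar> \<le> M" "n \<in> lattice d"
  shows "\<bar>walk d f n\<bar> \<le> M"
\<comment> \<open>In dimension \<open>0\<close> the average is \<open>0 / 0 = 0\<close>, and
  \<open>M\<close> is nonnegative because it bounds an absolute value.\<close>
proof (cases "d = 0")
  case True
  then show ?thesis using assms(1)[OF assms(2)] by (simp add: walk_def)
next
  case False
  have "\<bar>\<Sum>j<d. f (shift j (- 1) n) + f (shift j 1 n)\<bar> \<le> (\<Sum>j<d. 2 * M)"
  proof (rule order.trans[OF sum_abs sum_mono])
    show "\<bar>f (shift j (- 1) n) + f (shift j 1 n)\<bar> \<le> 2 * M" if "j \<in> {..<d}" for j
      using assms(1)[OF shift_lattice[of j d n "- 1"]] assms(1)[OF shift_lattice[of j d n 1]] assms(2) that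
      by simp
  qed
  then show ?thesis
    using False by (simp add: walk_def field_simps)
qed

lemma finsupp_walk: "finsupp d f \<Longrightarrow> finsupp d (walk d f)"
  unfolding walk_def divide_inverse
  by (intro finsupp_mult finsupp_sum finsupp_add finsupp_shift) auto

text \<open>Translation invariance of the sum trades a shift by \<open>a\<close> in \<open>f\<close>
  for a shift by \<open>- a\<close> in \<open>g\<close>, and the average contains both signs. Since
  \<open>g\<close> is arbitrary, weights of infinite support can be inserted later.\<close>

lemma lsum_walk_symmetric:
  assumes "finsupp d f"
  shows "lsum d (\<lambda>n. walk d f n * g n) = lsum d (\<lambda>n. f n * walk d g n)"
proof -
  have fs: "finsupp d (\<lambda>n. f (shift j a n) * g n)" "finsupp d (\<lambda>n. f n * g (shift j a n))"
    if "j < d" for j a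
    using that assms by (simp_all add: finsupp_mult finsupp_shift)
  have sh: "lsum d (\<lambda>n. f (shift j a n) * g n) = lsum d (\<lambda>n. f n * g (shift j (- a) n))"
    if "j < d" for j a
    using lsum_shift[OF that, of "\<lambda>n. f n * g (shift j (- a) n)" a] by simp
  have "lsum d (\<lambda>n. walk d f n * g n) =
      lsum d (\<lambda>n. (\<Sum>j<d. f (shift j (- 1) n) * g n + f (shift j 1 n) * g n) / (2 * real d))"
    by (simp add: walk_def sum_distrib_right distrib_right)
  also have "\<dots> = lsum d (\<lambda>n. \<Sum>j<d. f (shift j (- 1) n) * g n + f (shift j 1 n) * g n) / (2 * real d)"
    by (simp only: divide_inverse infsum_cmult_left')
  also have "lsum d (\<lambda>n. \<Sum>j<d. f (shift j (- 1) n) * g n + f (shift j 1 n) * g n) =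
      lsum d (\<lambda>n. \<Sum>j<d. f n * g (shift j (- 1) n) + f n * g (shift j 1 n))"
    using fs by (subst (1 2) lsum_sum) (auto simp: finsupp_add lsum_add sh add.commute)
  also have "\<dots> / (2 * real d) =
      lsum d (\<lambda>n. (\<Sum>j<d. f n * g (shift j (- 1) n) + f n * g (shift j 1 n)) / (2 * real d))"
    by (simp only: divide_inverse infsum_cmult_left')
  also have "\<dots> = lsum d (\<lambda>n. f n * walk d g n)"
    by (simp add: walk_def sum_distrib_left distrib_left)
  finally show ?thesis .
qed

text \<open>\<open>walk_poly d p\<close> is the operator \<open>p(P)\<close>, where \<open>P = walk d\<close>.\<close>

definition walk_poly :: "nat \<Rightarrow> real poly \<Rightarrow> ((nat \<Rightarrow> int) \<Rightarrow> real) \<Rightarrow> (nat \<Rightarrow> int) \<Rightarrow> real" where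
  "walk_poly d p f = fold_coeffs (\<lambda>a g n. a * f n + walk d g n) p (\<lambda>_. 0)"

lemma walk_poly_0 [simp]: "walk_poly d 0 f n = 0"
  by (simp add: walk_poly_def)

lemma walk_poly_pCons [simp]: "walk_poly d (pCons a p) f n = a * f n + walk d (walk_poly d p f) n"
\<comment> \<open>\<open>pCons 0 0\<close> is the zero polynomial, over which
  \<open>fold_coeffs\<close> performs no step; the equation then holds because the average of zero
  is zero.\<close>
proof (cases "p = 0 \<and> a = 0")
  case True
  then show ?thesis by (simp add: walk_poly_def walk_def)
next
  case False
  then show ?thesis
    by (cases "p = 0") (auto simp: walk_poly_def)
qed

lemma walk_poly_1 [simp]: "walk_poly d 1 f = f"
  using walk_poly_pCons[of d 1 0 f] by (auto simp: one_pCons walk_def)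

lemma walk_poly_const [simp]: "walk_poly d [:c:] f = (\<lambda>n. c * f n)"
  using walk_poly_pCons[of d c 0 f] by (auto simp: walk_def)

lemma walk_poly_X: "walk_poly d [:0, 1:] f = walk d f"
  using walk_poly_pCons[of d 0 "[:1:]" f] by (auto simp: walk_def)

lemma walk_poly_add: "walk_poly d (p + q) f n = walk_poly d p f n + walk_poly d q f n"
proof (induction p q arbitrary: n rule: poly_induct2)
  case (pCons a p b q)
  then have "walk_poly d (p + q) f = (\<lambda>n. walk_poly d p f n + walk_poly d q f n)"
    by auto
  then show ?case
    using walk_linear[of d 1 "walk_poly d p f" 1 "walk_poly d q f" n]
    by (simp add: algebra_simps)
qed simp

lemma walk_poly_smult: "walk_poly d (smult c p) f n = c * walk_poly d p f n"
proof (induction p arbitrary: n)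
  case (pCons a p)
  have "walk_poly d (smult c p) f = (\<lambda>n. c * walk_poly d p f n + 0 * 0)"
    using pCons by auto
  then show ?case
    using walk_linear[of d c "walk_poly d p f" 0 "\<lambda>_. 0" n] by (simp add: algebra_simps)
qed simp

lemma walk_poly_diff: "walk_poly d (p - q) f n = walk_poly d p f n - walk_poly d q f n"
  using walk_poly_add[of d p "smult (- 1) q" f n] walk_poly_smult[of d "- 1" q f n] by simp

text \<open>With additivity this makes \<open>p \<mapsto> p(P)\<close> an algebra homomorphism, so
  commutation of operators reduces to commutativity of polynomial multiplication.\<close>

lemma walk_poly_mult: "walk_poly d (p * q) f = walk_poly d p (walk_poly d q f)"
proof
  show "walk_poly d (p * q) f n = walk_poly d p (walk_poly d q f) n" for n
  proof (induction p arbitrary: n)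
    case (pCons a p)
    then have "walk_poly d (p * q) f = walk_poly d p (walk_poly d q f)"
      by auto
    then show ?case
      by (simp add: walk_poly_add walk_poly_smult)
  qed simp
qed

lemma walk_poly_sum: "walk_poly d (\<Sum>i\<in>I. p i) f n = (\<Sum>i\<in>I. walk_poly d (p i) f n)"
  by (induction I rule: infinite_finite_induct) (simp_all add: walk_poly_add)

lemma walk_poly_linear:
  "walk_poly d p (\<lambda>n. a * f n + b * g n) n = a * walk_poly d p f n + b * walk_poly d p g n"
proof (induction p arbitrary: n)
  case (pCons c p)
  then have "walk_poly d p (\<lambda>n. a * f n + b * g n) = (\<lambda>n. a * walk_poly d p f n + b * walk_poly d p g n)"
    by auto
  then show ?case
    by (simp add: walk_linear algebra_simps)
qed simp

lemma finsupp_walk_poly: "finsupp d f \<Longrightarrow> finsupp d (walk_poly d p f)"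
proof (induction p)
  case 0
  then show ?case by (auto simp: finsupp_def)
next
  case (pCons a p)
  have "finsupp d (\<lambda>n. a * f n + walk d (walk_poly d p f) n)"
    using pCons finsupp_mono[of d f "\<lambda>n. a * f n"] by (intro finsupp_add finsupp_walk) auto
  then show ?case
    by (rule finsupp_mono) auto
qed

lemma lsum_walk_poly_symmetric:
  assumes "finsupp d f"
  shows "lsum d (\<lambda>n. walk_poly d p f n * g n) = lsum d (\<lambda>n. f n * walk_poly d p g n)"
proof (induction p arbitrary: g)
  case (pCons a p)
  have fs: "finsupp d (\<lambda>n. f n * h n)" "finsupp d (\<lambda>n. walk d (walk_poly d p f) n * h n)" for h
    using assms by (simp_all add: finsupp_mult finsupp_walk finsupp_walk_poly)
  \<comment> \<open>Moving the outer average onto \<open>g\<close> calls for the induction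
    hypothesis at \<open>walk d g\<close>; commutation restores the order of the operators.\<close>
  have comm: "walk_poly d p (walk d h) = walk d (walk_poly d p h)" for h
    using walk_poly_mult[of d p "[:0, 1:]" h] walk_poly_mult[of d "[:0, 1:]" p h]
    by (simp add: walk_poly_X mult.commute)
  have "lsum d (\<lambda>n. walk_poly d (pCons a p) f n * g n) =
      lsum d (\<lambda>n. f n * (a * g n) + walk d (walk_poly d p f) n * g n)"
    by (simp add: algebra_simps)
  also have "\<dots> = lsum d (\<lambda>n. f n * (a * g n)) + lsum d (\<lambda>n. walk d (walk_poly d p f) n * g n)"
    by (rule lsum_add) (rule fs)+
  also have "\<dots> = lsum d (\<lambda>n. f n * (a * g n)) + lsum d (\<lambda>n. f n * walk d (walk_poly d p g) n)"
    by (simp add: lsum_walk_symmetric[OF finsupp_walk_poly[OF assms]] pCons comm)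
  also have "\<dots> = lsum d (\<lambda>n. f n * (a * g n) + f n * walk d (walk_poly d p g) n)"
    by (rule lsum_add[symmetric]) (rule fs)+
  finally show ?case
    by (simp add: algebra_simps)
qed simp

section \<open>The Laplacian and the positivity of its odd powers\<close>

lemma walk_poly_laplacian:
  assumes "d > 0"
  shows "walk_poly d [:2 * real d, - (2 * real d):] f n =
    (\<Sum>j<d. 2 * f n - f (shift j (- 1) n) - f (shift j 1 n))"
proof -
  have "walk d (\<lambda>n. - (2 * real d) * f n) n = - (2 * real d) * walk d f n"
    using walk_linear[of d "- (2 * real d)" f 0 f n] by simp
  also have "\<dots> = - (\<Sum>j<d. f (shift j (- 1) n) + f (shift j 1 n))"
    using assms by (simp add: walk_def)
  finally show ?thesis
    by (simp add: sum_subtractf sum.distrib)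
qed

lemma dirichlet_form:
  assumes "finsupp d f" "d > 0"
  shows "lsum d (\<lambda>n. f n * walk_poly d [:2 * real d, - (2 * real d):] f n) =
    lsum d (\<lambda>n. \<Sum>j<d. (f n - f (shift j (- 1) n))\<^sup>2)"
proof -
  define h where "h = (\<lambda>j n. f n * (f n - f (shift j 1 n)))"
  have fh: "finsupp d (h j)" for j
    unfolding h_def using assms(1) by (rule finsupp_mult)
  \<comment> \<open>Summation by parts: the squared difference equals \<open>f\<close> times the
    second difference up to a discrete divergence of \<open>h j\<close>, whose sum vanishes by
    translation invariance.\<close>
  have eq: "(f n - f (shift j (- 1) n))\<^sup>2 =
      f n * (2 * f n - f (shift j (- 1) n) - f (shift j 1 n)) + (h j (shift j (- 1) n) - h j n)" for j n
    by (simp add: h_def power2_eq_square algebra_simps)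
  have "lsum d (\<lambda>n. \<Sum>j<d. (f n - f (shift j (- 1) n))\<^sup>2) =
      lsum d (\<lambda>n. (\<Sum>j<d. f n * (2 * f n - f (shift j (- 1) n) - f (shift j 1 n))) +
        (\<Sum>j<d. h j (shift j (- 1) n) - h j n))"
    by (simp add: eq sum.distrib)
  also have "\<dots> = lsum d (\<lambda>n. \<Sum>j<d. f n * (2 * f n - f (shift j (- 1) n) - f (shift j 1 n))) +
      lsum d (\<lambda>n. \<Sum>j<d. h j (shift j (- 1) n) - h j n)"
    by (rule lsum_add; rule finsupp_sum)
      (use assms(1) fh in \<open>auto intro!: finsupp_mult finsupp_diff finsupp_shift\<close>)
  also have "lsum d (\<lambda>n. \<Sum>j<d. h j (shift j (- 1) n) - h j n) = 0"
    by (subst lsum_sum) (auto simp: fh finsupp_diff finsupp_shift lsum_diff lsum_shift)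
  also have "(\<lambda>n. \<Sum>j<d. f n * (2 * f n - f (shift j (- 1) n) - f (shift j 1 n))) =
      (\<lambda>n. f n * walk_poly d [:2 * real d, - (2 * real d):] f n)"
    using assms(2) by (simp only: walk_poly_laplacian flip: sum_distrib_left)
  finally show ?thesis by simp
qed

text \<open>Symmetry moves \<open>k\<close> of the \<open>2 * k + 1\<close> factors to the left, so
  the sign of the form is decided by the single factor left in the middle.\<close>

lemma lsum_odd_pow:
  assumes "finsupp d f"
  shows "lsum d (\<lambda>n. f n * walk_poly d (p ^ (2 * k + 1)) f n) =
    lsum d (\<lambda>n. walk_poly d (p ^ k) f n * walk_poly d p (walk_poly d (p ^ k) f) n)"
proof -
  have "p ^ (2 * k + 1) = p ^ k * (p * p ^ k)"
    by (simp only: mult_2 power_add power_one_right) (simp only: mult_ac)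
  then show ?thesis
    by (simp only: walk_poly_mult lsum_walk_poly_symmetric[OF assms])
qed

lemma one_minus_walk_pow_positive:
  assumes "finsupp d f" "d > 0" "0 \<le> r" "r \<le> 1"
  shows "0 \<le> lsum d (\<lambda>n. f n * walk_poly d ([:1, - r:] ^ (2 * k + 1)) f n)"
proof -
  define y where "y = walk_poly d ([:1, - r:] ^ k) f"
  have fy: "finsupp d y"
    unfolding y_def using assms(1) by (rule finsupp_walk_poly)
  \<comment> \<open>\<open>1 - r P\<close> is a convex combination of the identity and
    \<open>1 - P\<close>, the Laplacian divided by \<open>2 * d\<close>; both have nonnegative
    quadratic forms.\<close>
  have "[:1, - r:] = smult (1 - r) 1 + smult (r / (2 * real d)) [:2 * real d, - (2 * real d):]"
    using assms(2) by (simp add: one_pCons)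
  then have y: "walk_poly d [:1, - r:] y n =
      (1 - r) * y n + r / (2 * real d) * walk_poly d [:2 * real d, - (2 * real d):] y n" for n
    by (simp only: walk_poly_add walk_poly_smult walk_poly_1)
  have "lsum d (\<lambda>n. f n * walk_poly d ([:1, - r:] ^ (2 * k + 1)) f n) =
      lsum d (\<lambda>n. y n * walk_poly d [:1, - r:] y n)"
    unfolding y_def by (rule lsum_odd_pow[OF assms(1)])
  also have "\<dots> = lsum d (\<lambda>n. (1 - r) * (y n)\<^sup>2 +
      r / (2 * real d) * (y n * walk_poly d [:2 * real d, - (2 * real d):] y n))"
    by (simp only: y power2_eq_square distrib_left mult_ac)
  also have "\<dots> = lsum d (\<lambda>n. (1 - r) * (y n)\<^sup>2) +
      lsum d (\<lambda>n. r / (2 * real d) * (y n * walk_poly d [:2 * real d, - (2 * real d):] y n))"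
    by (rule lsum_add; rule finsupp_mono[OF fy]) simp_all
  also have "\<dots> = (1 - r) * lsum d (\<lambda>n. (y n)\<^sup>2) +
      r / (2 * real d) * lsum d (\<lambda>n. \<Sum>j<d. (y n - y (shift j (- 1) n))\<^sup>2)"
    by (simp only: infsum_cmult_right' dirichlet_form[OF fy assms(2)])
  also have "\<dots> \<ge> 0"
    using assms by (intro add_nonneg_nonneg mult_nonneg_nonneg infsum_nonneg sum_nonneg) auto
  finally show ?thesis .
qed

section \<open>Contraction and positivity of powers of \<open>r P\<close>\<close>

lemma abs_walk_poly_pow_X_le:
  assumes "0 \<le> r" "\<And>n. n \<in> lattice d \<Longrightarrow> \<bar>f n\<bar> \<le> M" "n \<in> lattice d"
  shows "\<bar>walk_poly d ([:0, r:] ^ i) f n\<bar> \<le> r ^ i * M"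
  using assms(3)
proof (induction i arbitrary: n)
  case (Suc i)
  have "\<bar>walk d (\<lambda>n. r * walk_poly d ([:0, r:] ^ i) f n) n\<bar> \<le> r * (r ^ i * M)"
    by (rule abs_walk_le) (use Suc assms(1) in \<open>auto simp: abs_mult intro!: mult_left_mono\<close>)
  then show ?case
    by (simp add: walk_poly_mult mult_ac del: mult_pCons_left)
qed (use assms(2) in simp)

lemma walk_poly_pow_X_nonneg:
  assumes "0 \<le> r" "\<And>n. 0 \<le> f n"
  shows "0 \<le> walk_poly d ([:0, r:] ^ i) f n"
proof (induction i arbitrary: n)
  case (Suc i)
  have "0 \<le> walk d (\<lambda>n. r * walk_poly d ([:0, r:] ^ i) f n) n"
    by (rule walk_nonneg) (use Suc assms(1) in auto)
  then show ?case
    by (simp add: walk_poly_mult del: mult_pCons_left)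
qed (use assms(2) in simp)

section \<open>Truncated Neumann series and the Schur test\<close>

definition neumann :: "real \<Rightarrow> nat \<Rightarrow> real poly" where
  "neumann r L = (\<Sum>i<L. [:0, r:] ^ i)"

lemma one_minus_mult_neumann: "[:1, - r:] * neumann r L = 1 - [:0, r:] ^ L"
  using one_diff_power_eq[of "[:0, r:]" L] by (simp add: neumann_def one_pCons del: mult_pCons_left)

lemma neumann_pow_nonneg:
  assumes "0 \<le> r" "\<And>n. 0 \<le> f n"
  shows "0 \<le> walk_poly d (neumann r L ^ m) f n"
proof (induction m arbitrary: n)
  case (Suc m)
  then show ?case
    using assms(1)
    by (auto simp: walk_poly_mult neumann_def walk_poly_sum intro!: sum_nonneg walk_poly_pow_X_nonneg)
qed (use assms(2) in simp)

text \<open>Each factor is dominated by the full geometric series \<open>1 / (1 - r)\<close>. The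
  bound is uniform in \<open>L\<close>, so that for fixed \<open>r\<close> the truncation error can
  be sent to zero.\<close>

lemma abs_neumann_pow_le:
  assumes "0 \<le> r" "r < 1" "\<And>n. n \<in> lattice d \<Longrightarrow> \<bar>f n\<bar> \<le> M" "n \<in> lattice d"
  shows "\<bar>walk_poly d (neumann r L ^ m) f n\<bar> \<le> M / (1 - r) ^ m"
  using assms(4)
proof (induction m arbitrary: n)
  case (Suc m)
  define g where "g = walk_poly d (neumann r L ^ m) f"
  define N where "N = M / (1 - r) ^ m"
  have g: "\<bar>g n\<bar> \<le> N" if "n \<in> lattice d" for n
    using Suc.IH[OF that] by (simp add: g_def N_def)
  from g[OF Suc.prems] have "0 \<le> N" by linarith
  have "\<bar>walk_poly d (neumann r L) g n\<bar> \<le> (\<Sum>i<L. \<bar>walk_poly d ([:0, r:] ^ i) g n\<bar>)"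
    by (simp add: neumann_def walk_poly_sum)
  also have "\<dots> \<le> (\<Sum>i<L. r ^ i * N)"
    by (intro sum_mono abs_walk_poly_pow_X_le) (use assms(1) g Suc.prems in auto)
  also have "\<dots> = (1 - r ^ L) / (1 - r) * N"
    using assms(2) by (simp add: sum_gp_strict flip: sum_distrib_right)
  also have "\<dots> \<le> 1 / (1 - r) * N"
    using assms \<open>0 \<le> N\<close> by (intro mult_right_mono divide_right_mono) auto
  finally show ?case
    by (simp add: walk_poly_mult g_def N_def field_simps)
qed (use assms(3) in simp)

lemma abs_one_minus_pow_X_diff_le:
  assumes "0 \<le> r" "r \<le> 1" "\<And>n. n \<in> lattice d \<Longrightarrow> \<bar>f n\<bar> \<le> M" "n \<in> lattice d"
  shows "\<bar>walk_poly d ((1 - [:0, r:] ^ L) ^ m) f n - f n\<bar> \<le> 2 ^ m * r ^ L * M"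
proof -
  define B where "B = (\<lambda>m. walk_poly d ((1 - [:0, r:] ^ L) ^ m))"
  \<comment> \<open>The two bounds are proved together. A new factor subtracts
    \<open>(r P) ^ L g\<close> from \<open>g\<close>, which is at most \<open>r ^ L\<close> times
    the sup bound on \<open>g\<close>; as \<open>r ^ L \<le> 1\<close>, both bounds at most
    double.\<close>
  have "\<bar>B m f n\<bar> \<le> 2 ^ m * M \<and> \<bar>B m f n - f n\<bar> \<le> 2 ^ m * r ^ L * M"
    using assms(4)
  proof (induction m arbitrary: n)
    case 0
    then have "0 \<le> M" using assms(3)[of n] by linarith
    then show ?case
      using 0 assms(1,3) by (simp add: B_def)
  next
    case (Suc m)
    define g where "g = B m f"
    define c where "c = 2 ^ m * M"
    have g: "\<bar>g n\<bar> \<le> c" "\<bar>g n - f n\<bar> \<le> r ^ L * c" if "n \<in> lattice d" for n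
      using Suc.IH[OF that] by (simp_all add: g_def c_def mult_ac)
    from g(1)[OF Suc.prems] have "0 \<le> c" by linarith
    then have "r ^ L * c \<le> 1 * c"
      by (intro mult_right_mono power_le_one) (use assms in auto)
    moreover have "\<bar>walk_poly d ([:0, r:] ^ L) g n\<bar> \<le> r ^ L * c"
      by (rule abs_walk_poly_pow_X_le) (use assms(1) Suc.prems g in auto)
    moreover have "B (Suc m) f n = g n - walk_poly d ([:0, r:] ^ L) g n"
      by (simp add: B_def g_def walk_poly_mult walk_poly_diff del: mult_pCons_left)
    ultimately have "\<bar>B (Suc m) f n\<bar> \<le> 2 * c \<and> \<bar>B (Suc m) f n - f n\<bar> \<le> 2 * (r ^ L * c)"
      using g[OF Suc.prems] by linarith
    then show ?case
      by (simp add: c_def mult_ac)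
  qed
  then show ?thesis
    by (simp add: B_def)
qed

text \<open>Positivity on functions takes the place of a nonnegative kernel. A pointwise AM-GM bound
  splits the form into two halves, which symmetry shows to be equal; the supersolution
  \<open>\<phi>\<close> then bounds their sum.\<close>

lemma schur_test:
  assumes "finsupp d v" "\<And>n. \<phi> n > 0" "\<And>n. walk_poly d p \<phi> n \<le> W n * \<phi> n"
    and nonneg: "\<And>f n. (\<And>n. 0 \<le> f n) \<Longrightarrow> 0 \<le> walk_poly d p f n"
  shows "lsum d (\<lambda>n. v n * walk_poly d p v n) \<le> lsum d (\<lambda>n. (v n)\<^sup>2 * W n)"
proof -
  define T where "T = walk_poly d p"
  define z where "z = (\<lambda>n. (v n)\<^sup>2 / \<phi> n)"
  have fz: "finsupp d z"
    using assms(1) by (rule finsupp_mono) (simp add: z_def)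
  \<comment> \<open>AM-GM: \<open>2 v(x) v(n) \<le> v(x)\<^sup>2 \<phi>(n) / \<phi>(x) + v(n)\<^sup>2 \<phi>(x) / \<phi>(n)\<close>, to which \<open>T\<close> is applied in \<open>n\<close>.\<close>
  have pointwise: "v x * T v x \<le> z x * T \<phi> x / 2 + \<phi> x * T z x / 2" for x
  proof -
    \<comment> \<open>The coefficients, including the factor \<open>1\<close>, are written out so
      that \<open>walk_poly_linear\<close> can expand both nested combinations.\<close>
    have "0 \<le> T (\<lambda>n. 1 * (z x / 2 * \<phi> n + \<phi> x / 2 * z n) + (- v x) * v n) x"
      unfolding T_def
    proof (rule nonneg)
      fix n
      have "1 * (z x / 2 * \<phi> n + \<phi> x / 2 * z n) + (- v x) * v n = (v x * \<phi> n - v n * \<phi> x)\<^sup>2 / (2 * \<phi> x * \<phi> n)"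
        using assms(2)[of n] assms(2)[of x] by (simp add: z_def field_simps power2_eq_square)
      then show "0 \<le> 1 * (z x / 2 * \<phi> n + \<phi> x / 2 * z n) + (- v x) * v n"
        using assms(2)[of n] assms(2)[of x] by simp
    qed
    then show ?thesis
      unfolding T_def walk_poly_linear by simp
  qed
  have "lsum d (\<lambda>n. v n * T v n) \<le> lsum d (\<lambda>n. z n * T \<phi> n / 2 + \<phi> n * T z n / 2)"
    using pointwise
    by (intro lsum_mono)
      (auto simp: T_def assms(1) fz intro!: finsupp_mult finsupp_add intro: finsupp_mono[OF fz] finsupp_mono[OF finsupp_walk_poly[OF fz]])
  also have "\<dots> = lsum d (\<lambda>n. z n * T \<phi> n / 2) + lsum d (\<lambda>n. \<phi> n * T z n / 2)"
    by (rule lsum_add) (auto simp: T_def intro: finsupp_mono[OF fz] finsupp_mono[OF finsupp_walk_poly[OF fz]])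
  also have "\<dots> = lsum d (\<lambda>n. z n * T \<phi> n) / 2 + lsum d (\<lambda>n. T z n * \<phi> n) / 2"
    by (simp only: divide_inverse infsum_cmult_left') (simp add: mult.commute)
  also have "lsum d (\<lambda>n. T z n * \<phi> n) = lsum d (\<lambda>n. z n * T \<phi> n)"
    unfolding T_def by (rule lsum_walk_poly_symmetric[OF fz])
  also have "lsum d (\<lambda>n. z n * T \<phi> n) / 2 + lsum d (\<lambda>n. z n * T \<phi> n) / 2 = lsum d (\<lambda>n. z n * T \<phi> n)"
    by simp
  also have "\<dots> \<le> lsum d (\<lambda>n. (v n)\<^sup>2 * W n)"
  proof (rule lsum_mono)
    fix n
    have "z n * T \<phi> n \<le> z n * (W n * \<phi> n)"
      using assms(2)[of n] assms(3)[of n] by (intro mult_left_mono) (auto simp: z_def T_def)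
    then show "z n * T \<phi> n \<le> (v n)\<^sup>2 * W n"
      using assms(2)[of n] by (simp add: z_def)
  qed (auto intro: finsupp_mono[OF fz] finsupp_mono[OF assms(1)])
  finally show ?thesis
    by (simp add: T_def)
qed

text \<open>
  With \<open>A = (1 - r P)\<^sup>m\<close>, its approximate inverse \<open>G\<close> and \<open>v = u / W\<close>, expand
  \<open>0 \<le> \<langle>A (u - G v), u - G v\<rangle>\<close>; up to the truncation error this is
  \<open>\<langle>A u, u\<rangle> - 2 \<langle>u, v\<rangle> + \<langle>G v, v\<rangle>\<close>, and the Schur test bounds the last term by \<open>\<langle>W v, v\<rangle> = \<langle>u, v\<rangle>\<close>.
\<close>

lemma damped_lower_bound:
  fixes W :: "(nat \<Rightarrow> int) \<Rightarrow> real" and k :: nat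
  defines "m \<equiv> 2 * k + 1"
  assumes u: "finsupp d u" and "d > 0" and r: "0 \<le> r" "r < 1"
    and \<phi>: "\<And>n. \<phi> n > 0" and W: "\<And>n. W n > 0"
    and super: "\<And>L n. walk_poly d (neumann r L ^ m) \<phi> n \<le> W n * \<phi> n"
  shows "lsum d (\<lambda>n. (u n)\<^sup>2 / W n) \<le> lsum d (\<lambda>n. u n * walk_poly d ([:1, - r:] ^ m) u n)"
proof -
  define v where "v = (\<lambda>n. u n / W n)"
  define A where "A = [:1, - r:] ^ m"
  define G where "G = (\<lambda>L. neumann r L ^ m)"
  define B where "B = (\<lambda>L. (1 - [:0, r:] ^ L) ^ m)"
  have v: "finsupp d v"
    using u by (rule finsupp_mono) (simp add: v_def)
  have "A * G L = B L" for L
    unfolding A_def G_def B_def by (simp only: one_minus_mult_neumann flip: power_mult_distrib)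
  then have AG: "walk_poly d A (walk_poly d (G L) f) = walk_poly d (B L) f"
    and GA: "walk_poly d (G L) (walk_poly d A f) = walk_poly d (B L) f" for L f
    by (metis walk_poly_mult mult.commute)+
  have bounded: "\<exists>M. \<forall>n\<in>lattice d. \<bar>f n\<bar> \<le> M" if "finsupp d f" for f
  proof (intro exI ballI)
    fix n assume "n \<in> lattice d"
    then show "\<bar>f n\<bar> \<le> (\<Sum>n\<in>{n \<in> lattice d. f n \<noteq> 0}. \<bar>f n\<bar>)"
      using that member_le_sum[of n "{n \<in> lattice d. f n \<noteq> 0}" "\<lambda>n. \<bar>f n\<bar>"]
      by (cases "f n = 0") (auto simp: finsupp_def intro: sum_nonneg)
  qed
  have null: "(\<lambda>L. C * r ^ L * M) \<longlonglongrightarrow> 0" for C M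
    using r by (auto intro!: tendsto_eq_intros LIMSEQ_realpow_zero)
  have B_lim: "(\<lambda>L. walk_poly d (B L) f n) \<longlonglongrightarrow> f n" if f: "finsupp d f" and n: "n \<in> lattice d" for f n
  proof -
    obtain M where M: "\<And>n. n \<in> lattice d \<Longrightarrow> \<bar>f n\<bar> \<le> M"
      using bounded[OF f] by blast
    have "(\<lambda>L. walk_poly d (B L) f n - f n) \<longlonglongrightarrow> 0"
      by (rule Lim_null_comparison[OF _ null[of "2 ^ m" M]])
        (use r M n abs_one_minus_pow_X_diff_le[of r d f M n] in \<open>auto simp: B_def\<close>)
    then show ?thesis by (simp add: LIM_zero_iff)
  qed
  \<comment> \<open>\<open>G L\<close> varies with \<open>L\<close>, so convergence of its argument
    alone is not enough; its sup-norm bound \<open>1 / (1 - r) ^ m\<close> is uniform in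
    \<open>L\<close> and the argument decays like \<open>r ^ L\<close>.\<close>
  have E_lim: "(\<lambda>L. walk_poly d (G L) (\<lambda>n. walk_poly d (B L) v n - v n) n) \<longlonglongrightarrow> 0"
    if n: "n \<in> lattice d" for n
  proof -
    obtain M where M: "\<And>n. n \<in> lattice d \<Longrightarrow> \<bar>v n\<bar> \<le> M"
      using bounded[OF v] by blast
    have bound: "\<bar>walk_poly d (G L) (\<lambda>n. walk_poly d (B L) v n - v n) n\<bar> \<le> (2 ^ m * r ^ L * M) / (1 - r) ^ m" for L
      unfolding G_def
      by (rule abs_neumann_pow_le)
        (use r M n abs_one_minus_pow_X_diff_le[of r d v M] in \<open>auto simp: B_def\<close>)
    have lim: "(\<lambda>L. (2 ^ m * r ^ L * M) / (1 - r) ^ m) \<longlonglongrightarrow> 0"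
      using tendsto_divide[OF null[of "2 ^ m" M] tendsto_const[of "(1 - r) ^ m"]] r by simp
    show ?thesis
      by (rule Lim_null_comparison[OF _ lim]) (simp only: real_norm_def bound eventually_True)
  qed
  define Q where "Q = lsum d (\<lambda>n. u n * walk_poly d A u n)"
  define R where "R = lsum d (\<lambda>n. (u n)\<^sup>2 / W n)"
  have expand: "0 \<le> Q - lsum d (\<lambda>n. u n * walk_poly d (B L) v n) - lsum d (\<lambda>n. v n * walk_poly d (B L) u n) + R
      + lsum d (\<lambda>n. v n * walk_poly d (G L) (\<lambda>n. walk_poly d (B L) v n - v n) n)" for L
  proof -
    define g where "g = walk_poly d (G L) v"
    define b where "b = walk_poly d (B L) v"
    define a where "a = walk_poly d A u"
    define x where "x = (\<lambda>n. u n - g n)"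
    have g: "finsupp d g"
      unfolding g_def using v by (rule finsupp_walk_poly)
    have Ax: "walk_poly d A x n = a n - b n" for n
      using walk_poly_linear[of d A 1 u "- 1" g n] by (simp add: x_def a_def b_def g_def AG)
    have prod: "x n * walk_poly d A x n = ((u n * a n - u n * b n) - g n * a n) + g n * b n" for n
      unfolding Ax by (simp add: x_def algebra_simps)
    have "0 \<le> lsum d (\<lambda>n. x n * walk_poly d A x n)"
      unfolding A_def m_def
      by (rule one_minus_walk_pow_positive) (use \<open>d > 0\<close> r in \<open>auto simp: x_def finsupp_diff u g\<close>)
    also have "\<dots> = lsum d (\<lambda>n. ((u n * a n - u n * b n) - g n * a n) + g n * b n)"
      by (simp only: prod)
    also have "\<dots> = lsum d (\<lambda>n. u n * a n) - lsum d (\<lambda>n. u n * b n) - lsum d (\<lambda>n. g n * a n) + lsum d (\<lambda>n. g n * b n)"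
      by (simp add: lsum_add lsum_diff finsupp_diff finsupp_mult u g)
    also have "lsum d (\<lambda>n. u n * a n) = Q"
      by (simp add: Q_def a_def)
    also have "lsum d (\<lambda>n. g n * a n) = lsum d (\<lambda>n. v n * walk_poly d (B L) u n)"
      unfolding g_def a_def by (simp only: lsum_walk_poly_symmetric[OF v] GA)
    also have "lsum d (\<lambda>n. g n * b n) = lsum d (\<lambda>n. v n * walk_poly d (G L) b n)"
      unfolding g_def by (simp only: lsum_walk_poly_symmetric[OF v])
    \<comment> \<open>Writing \<open>b = v + (b - v)\<close> separates the term for the Schur test
      from the truncation error.\<close>
    also have "\<dots> = lsum d (\<lambda>n. v n * g n + v n * walk_poly d (G L) (\<lambda>n. b n - v n) n)"
    proof -
      have "walk_poly d (G L) (\<lambda>n. b n - v n) n = walk_poly d (G L) b n - g n" for n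
        using walk_poly_linear[of d "G L" 1 b "- 1" v] by (simp add: g_def)
      then show ?thesis by (simp add: right_diff_distrib)
    qed
    also have "\<dots> = lsum d (\<lambda>n. v n * g n) + lsum d (\<lambda>n. v n * walk_poly d (G L) (\<lambda>n. b n - v n) n)"
      by (rule lsum_add) (rule finsupp_mult[OF v])+
    also have "lsum d (\<lambda>n. v n * g n) \<le> lsum d (\<lambda>n. (v n)\<^sup>2 * W n)"
      unfolding g_def G_def
      by (rule schur_test[OF v \<phi> super]) (rule neumann_pow_nonneg[OF r(1)])
    also have "(\<lambda>n. (v n)\<^sup>2 * W n) = (\<lambda>n. (u n)\<^sup>2 / W n)"
    proof
      show "(v n)\<^sup>2 * W n = (u n)\<^sup>2 / W n" for n
        using W[of n] by (simp add: v_def power2_eq_square)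
    qed
    finally show ?thesis
      by (simp add: R_def b_def)
  qed
  have uv: "lsum d (\<lambda>n. u n * v n) = R"
    by (simp add: v_def R_def power2_eq_square)
  have "(\<lambda>L. Q - lsum d (\<lambda>n. u n * walk_poly d (B L) v n) - lsum d (\<lambda>n. v n * walk_poly d (B L) u n) + R
      + lsum d (\<lambda>n. v n * walk_poly d (G L) (\<lambda>n. walk_poly d (B L) v n - v n) n))
    \<longlonglongrightarrow> Q - lsum d (\<lambda>n. u n * v n) - lsum d (\<lambda>n. v n * u n) + R + lsum d (\<lambda>n. v n * 0)"
    by (intro tendsto_intros tendsto_lsum_mult u v B_lim E_lim)
  then have "0 \<le> Q - lsum d (\<lambda>n. u n * v n) - lsum d (\<lambda>n. v n * u n) + R + lsum d (\<lambda>n. v n * 0)"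
    by (rule LIMSEQ_le_const) (use expand in auto)
  also have "\<dots> = Q - R"
    using uv by (simp add: mult.commute)
  finally show ?thesis
    by (simp add: Q_def R_def A_def)
qed

text \<open>The hypothesis \<open>super\<close> holds with one \<open>W\<close> for all
  \<open>r < 1\<close>, so the damped bounds share their left-hand side; the right-hand side is
  continuous in \<open>r\<close>, and \<open>r\<close> tends to \<open>1\<close> along
  \<open>s\<close>.\<close>

lemma undamped_lower_bound:
  fixes W :: "(nat \<Rightarrow> int) \<Rightarrow> real" and k :: nat
  defines "m \<equiv> 2 * k + 1"
  assumes u: "finsupp d u" and "d > 0"
    and \<phi>: "\<And>n. \<phi> n > 0" and W: "\<And>n. W n > 0"
    and super: "\<And>r L n. 0 \<le> r \<Longrightarrow> r < 1 \<Longrightarrow> walk_poly d (neumann r L ^ m) \<phi> n \<le> W n * \<phi> n"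
  shows "lsum d (\<lambda>n. (u n)\<^sup>2 / W n) \<le> lsum d (\<lambda>n. u n * walk_poly d ([:1, - 1:] ^ m) u n)"
proof -
  define s :: "nat \<Rightarrow> real" where "s = (\<lambda>i. 1 - 1 / real (Suc i))"
  have s: "s \<longlonglongrightarrow> 1"
    unfolding s_def using tendsto_diff[OF tendsto_const[of 1] LIMSEQ_inverse_real_of_nat]
    by (simp add: divide_inverse)
  have "(\<lambda>i. walk_poly d ([:1, - s i:] ^ j) u n) \<longlonglongrightarrow> walk_poly d ([:1, - 1:] ^ j) u n" for j n
  proof (induction j arbitrary: n)
    case (Suc j)
    have "walk_poly d ([:1, - t:] ^ Suc j) u n =
        walk_poly d ([:1, - t:] ^ j) u n - t * walk d (walk_poly d ([:1, - t:] ^ j) u) n" for t n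
      using walk_linear[of d "- t" "walk_poly d ([:1, - t:] ^ j) u" 0 u n]
      by (simp add: walk_poly_mult del: mult_pCons_left)
    moreover have "(\<lambda>i. walk_poly d ([:1, - s i:] ^ j) u n - s i * walk d (walk_poly d ([:1, - s i:] ^ j) u) n)
        \<longlonglongrightarrow> walk_poly d ([:1, - 1:] ^ j) u n - 1 * walk d (walk_poly d ([:1, - 1:] ^ j) u) n"
      unfolding walk_def divide_inverse by (intro tendsto_intros Suc s)
    ultimately show ?case by (simp only:)
  qed simp
  then have "(\<lambda>i. lsum d (\<lambda>n. u n * walk_poly d ([:1, - s i:] ^ m) u n))
      \<longlonglongrightarrow> lsum d (\<lambda>n. u n * walk_poly d ([:1, - 1:] ^ m) u n)"
    by (intro tendsto_lsum_mult u)
  then show ?thesis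
  proof (rule LIMSEQ_le_const)
    have "lsum d (\<lambda>n. (u n)\<^sup>2 / W n) \<le> lsum d (\<lambda>n. u n * walk_poly d ([:1, - s i:] ^ m) u n)" for i
      unfolding m_def
      by (rule damped_lower_bound[OF u \<open>d > 0\<close> _ _ \<phi> W super[unfolded m_def]])
        (auto simp: s_def field_simps)
    then show "\<exists>N. \<forall>i\<ge>N. lsum d (\<lambda>n. (u n)\<^sup>2 / W n) \<le> lsum d (\<lambda>n. u n * walk_poly d ([:1, - s i:] ^ m) u n)"
      by blast
  qed
qed

section \<open>Superharmonic weights\<close>

lemma inverse_power_le_quadratic:
  fixes t :: real
  assumes "t \<ge> - 3 / 4"
  shows "1 / (1 + t) ^ p \<le> 1 - p * t + 8 ^ p * t\<^sup>2"
proof (induction p)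
  case (Suc p)
  \<comment> \<open>After multiplication by \<open>1 + t\<close> the induction step amounts to
    \<open>8 ^ p + p + 1 \<le> 8 ^ Suc p * (1 + t)\<close> times the square of \<open>t\<close>.
    Since \<open>1 + t \<ge> 1 / 4\<close>, the right side is at least
    \<open>2 * 8 ^ p\<close>.\<close>
  have "p + 1 \<le> (8::real) ^ p"
    using linear_plus_1_le_power[of 7 p] by (simp add: algebra_simps)
  then have "8 ^ p + p + 1 \<le> 8 * 8 ^ p * (1 / 4 :: real)"
    by simp
  also have "\<dots> \<le> 8 * 8 ^ p * (1 + t)"
    using assms by (intro mult_left_mono) auto
  finally have "(8 ^ p + p + 1) * t\<^sup>2 \<le> 8 * 8 ^ p * (1 + t) * t\<^sup>2"
    by (intro mult_right_mono) auto
  then have "1 - p * t + 8 ^ p * t\<^sup>2 \<le> (1 - Suc p * t + 8 ^ Suc p * t\<^sup>2) * (1 + t)"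
    by (simp add: algebra_simps power2_eq_square)
  then have "1 / (1 + t) ^ p \<le> (1 - Suc p * t + 8 ^ Suc p * t\<^sup>2) * (1 + t)"
    using Suc by linarith
  then have "1 / (1 + t) ^ p / (1 + t) \<le> 1 - Suc p * t + 8 ^ Suc p * t\<^sup>2"
    using assms by (subst pos_divide_le_eq) auto
  then show ?case
    by (simp add: mult.commute)
qed simp

definition norm_sq :: "nat \<Rightarrow> (nat \<Rightarrow> int) \<Rightarrow> real" where
  "norm_sq d n = (\<Sum>i<d. (real_of_int (n i))\<^sup>2)"

lemma norm_sq_nonneg [simp]: "0 \<le> norm_sq d n"
  by (simp add: norm_sq_def sum_nonneg)

lemma norm_sq_shift:
  assumes "j < d"
  shows "norm_sq d (shift j a n) = norm_sq d n + 2 * a * n j + (real_of_int a)\<^sup>2"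
proof -
  have split: "norm_sq d m = (real_of_int (m j))\<^sup>2 + (\<Sum>i\<in>{..<d} - {j}. (real_of_int (m i))\<^sup>2)" for m
    unfolding norm_sq_def using assms by (subst sum.remove[of _ j]) auto
  have "(\<Sum>i\<in>{..<d} - {j}. (real_of_int (shift j a n i))\<^sup>2) = (\<Sum>i\<in>{..<d} - {j}. (real_of_int (n i))\<^sup>2)"
    by (rule sum.cong) (auto simp: shift_def)
  then show ?thesis
    by (simp add: split[of n] split[of "shift j a n"]) (simp add: shift_def power2_eq_square algebra_simps)
qed

definition weight :: "nat \<Rightarrow> nat \<Rightarrow> (nat \<Rightarrow> int) \<Rightarrow> real" where
  "weight d p n = 1 / (1 + norm_sq d n) ^ p"

lemma weight_pos: "weight d p n > 0"
  by (simp add: weight_def add_pos_nonneg)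

text \<open>The drift from \<open>\<rho>\<close> to \<open>y\<close> gains a relative amount of at
  least \<open>1 / \<rho>\<close>, while the quadratic error costs at most
  \<open>1 / (2 * y)\<close> once \<open>d \<ge> 8 ^ Suc p\<close>; at least half of the gain
  survives.\<close>

lemma walk_weight_le:
  assumes "p \<ge> 1" "8 ^ Suc p \<le> d"
  shows "walk d (weight d p) n \<le> weight d p n - weight d (Suc p) n / 2 ^ Suc p"
proof -
  define \<rho> where "\<rho> = 1 + norm_sq d n"
  \<comment> \<open>\<open>y\<close> is the mean of \<open>1 + norm_sq\<close> over the two
    neighbours in any coordinate direction; the deviations from it are \<open>2 * n j\<close> and
    \<open>- 2 * n j\<close>.\<close>
  define y where "y = \<rho> + 1"
  have \<rho>: "\<rho> \<ge> 1" by (simp add: \<rho>_def)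
  have y: "y \<ge> 2" "y \<le> 2 * \<rho>" using \<rho> by (simp_all add: y_def)
  have "(0::nat) < 8 ^ Suc p" by simp
  with assms have d: "d > 0" by linarith
  have neighbour: "weight d p (shift j a n) \<le> 1 / y ^ p * (1 - p * (2 * a * n j / y) + 8 ^ p * (2 * n j / y)\<^sup>2)"
    if "j < d" "a = 1 \<or> a = - 1" for j and a :: int
  proof -
    define t where "t = 2 * a * n j / y"
    have "(real_of_int (n j))\<^sup>2 \<le> norm_sq d n"
      unfolding norm_sq_def using that(1) by (intro member_le_sum) auto
    \<comment> \<open>These squares give \<open>24 * |n j| \<le> 9 * (n j)^2 + 16\<close>; with
      \<open>y \<ge> (n j)^2 + 2\<close> the relative deviation \<open>t\<close> has absolute value
      at most \<open>3 / 4\<close>.\<close>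
    moreover have "0 \<le> (3 * real_of_int (n j) + 4)\<^sup>2" "0 \<le> (3 * real_of_int (n j) - 4)\<^sup>2"
      by auto
    ultimately have "8 * \<bar>real_of_int (n j)\<bar> \<le> 3 * y"
      by (auto simp: y_def \<rho>_def power2_eq_square algebra_simps abs_if)
    then have "t \<ge> - 3 / 4"
      using that(2) y by (auto simp: t_def field_simps)
    have "(real_of_int a)\<^sup>2 = 1"
      using that(2) by auto
    moreover have "y * (1 + t) = y + 2 * a * n j"
      using y by (simp add: t_def distrib_left)
    ultimately have "y * (1 + t) = 1 + norm_sq d (shift j a n)"
      using that(1) by (simp add: norm_sq_shift y_def \<rho>_def)
    then have "weight d p (shift j a n) = 1 / (y * (1 + t)) ^ p"
      by (simp add: weight_def)
    also have "\<dots> = 1 / y ^ p * (1 / (1 + t) ^ p)"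
      by (simp add: power_mult_distrib)
    also have "\<dots> \<le> 1 / y ^ p * (1 - p * t + 8 ^ p * t\<^sup>2)"
      using inverse_power_le_quadratic[OF \<open>t \<ge> - 3 / 4\<close>] y by (intro mult_left_mono) auto
    also have "t\<^sup>2 = (2 * n j / y)\<^sup>2"
      using that(2) by (auto simp: t_def power_divide)
    finally show ?thesis by (simp add: t_def)
  qed
  have "(\<Sum>j<d. weight d p (shift j (- 1) n) + weight d p (shift j 1 n)) \<le>
      (\<Sum>j<d. 1 / y ^ p * (2 + 8 ^ Suc p / y\<^sup>2 * (real_of_int (n j))\<^sup>2))"
  proof (rule sum_mono)
    fix j assume "j \<in> {..<d}"
    then have "weight d p (shift j (- 1) n) + weight d p (shift j 1 n) \<le>
        1 / y ^ p * (1 - p * (2 * (- 1) * n j / y) + 8 ^ p * (2 * n j / y)\<^sup>2) +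
        1 / y ^ p * (1 - p * (2 * 1 * n j / y) + 8 ^ p * (2 * n j / y)\<^sup>2)"
      using neighbour[of j "- 1"] neighbour[of j 1] by simp
    also have "\<dots> = 1 / y ^ p * (2 + 8 ^ Suc p / y\<^sup>2 * (real_of_int (n j))\<^sup>2)"
    proof -
      have pair: "c * (1 - p * (2 * (- 1) * n j / y) + q * z) + c * (1 - p * (2 * 1 * n j / y) + q * z) = c * (2 + 2 * q * z)"
        for c q z
        by (simp add: algebra_simps)
      have "2 * 8 ^ p * (2 * n j / y)\<^sup>2 = 8 ^ Suc p / y\<^sup>2 * (real_of_int (n j))\<^sup>2"
        by (simp add: power_divide power_mult_distrib)
      then show ?thesis
        by (simp only: pair)
    qed
    finally show "weight d p (shift j (- 1) n) + weight d p (shift j 1 n) \<le>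
        1 / y ^ p * (2 + 8 ^ Suc p / y\<^sup>2 * (real_of_int (n j))\<^sup>2)" .
  qed
  also have "\<dots> = 1 / y ^ p * (2 * real d + 8 ^ Suc p / y\<^sup>2 * norm_sq d n)"
  proof -
    have "(\<Sum>j<d. b * (2 + c * f j)) = b * (2 * real d + c * (\<Sum>j<d. f j))" for b c :: real and f
      by (simp only: sum_distrib_left[symmetric] sum.distrib) simp
    then show ?thesis
      unfolding norm_sq_def .
  qed
  also have "\<dots> \<le> 1 / y ^ p * (2 * real d + d / y\<^sup>2 * y)"
  proof (intro mult_left_mono add_left_mono mult_mono divide_right_mono)
    show "8 ^ Suc p \<le> real d"
      using of_nat_mono[OF assms(2), where 'a = real] by simp
    show "norm_sq d n \<le> y"
      by (simp add: y_def \<rho>_def)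
  qed (use y in simp_all)
  also have "\<dots> = 2 * real d * (1 / y ^ p * (1 + 1 / (2 * y)))"
  proof -
    have "c * (2 * real d + d / y\<^sup>2 * y) = 2 * real d * (c * (1 + 1 / (2 * y)))" for c
      using y(1) by (simp add: field_simps power2_eq_square)
    then show ?thesis .
  qed
  finally have "walk d (weight d p) n \<le> 1 / y ^ p * (1 + 1 / (2 * y))"
    using d by (simp add: walk_def pos_divide_le_eq mult.commute)
  also have "\<dots> \<le> 1 / \<rho> ^ p - 1 / y ^ p * (1 / (2 * \<rho>))"
  proof -
    \<comment> \<open>Here \<open>p \<ge> 1\<close> enters:
      \<open>y / \<rho> = 1 + 1 / \<rho>\<close>, so passing from \<open>y ^ p\<close> to
      \<open>\<rho> ^ p\<close> yields the drift gain.\<close>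
    have "1 + 1 / \<rho> \<le> (1 + 1 / \<rho>) ^ p"
      using \<rho> assms(1) self_le_power[of "1 + 1 / \<rho>" p] by simp
    also have "\<dots> = (y / \<rho>) ^ p"
      using \<rho> by (simp add: y_def add_divide_distrib)
    finally have "1 / y ^ p * (1 + 1 / \<rho>) \<le> 1 / y ^ p * (y / \<rho>) ^ p"
      using y by (intro mult_left_mono) auto
    also have "\<dots> = 1 / \<rho> ^ p"
      using y by (simp add: power_divide)
    finally have "1 / y ^ p * (1 + 1 / \<rho>) \<le> 1 / \<rho> ^ p" .
    moreover have "1 / (2 * y) \<le> 1 / (2 * \<rho>)"
      using y \<rho> by (intro frac_le) (auto simp: y_def)
    then have "1 + 1 / (2 * y) \<le> (1 + 1 / \<rho>) - 1 / (2 * \<rho>)"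
      by simp
    then have "1 / y ^ p * (1 + 1 / (2 * y)) \<le> 1 / y ^ p * ((1 + 1 / \<rho>) - 1 / (2 * \<rho>))"
      using y by (intro mult_left_mono) auto
    ultimately show ?thesis
      unfolding right_diff_distrib by linarith
  qed
  \<comment> \<open>Replacing \<open>y\<close> by \<open>2 * \<rho>\<close> turns the remaining gain
    into a multiple of the next weight and produces the constant \<open>2 ^ Suc p\<close>.\<close>
  also have "\<dots> \<le> 1 / \<rho> ^ p - 1 / (2 * \<rho>) ^ p * (1 / (2 * \<rho>))"
    using y \<rho> by (intro diff_left_mono mult_right_mono frac_le power_mono) auto
  also have "\<dots> = weight d p n - weight d (Suc p) n / 2 ^ Suc p"
    by (simp add: weight_def power_mult_distrib flip: \<rho>_def)
  finally show ?thesis .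
qed

text \<open>The positive operator \<open>neumann r L\<close> is applied to
  \<open>w_(p+1) \<le> 2 ^ Suc m * (1 - r P) w_p\<close>; on the right it leaves \<open>w_p\<close>
  minus the nonnegative tail \<open>(r P) ^ L w_p\<close>. The constant depends on \<open>m\<close>
  only, which suits iteration over \<open>p \<le> m\<close>.\<close>

lemma neumann_weight_le:
  assumes "p \<ge> 1" "p \<le> m" "8 ^ Suc m \<le> d" "0 \<le> r" "r < 1"
  shows "walk_poly d (neumann r L) (weight d (Suc p)) n \<le> 2 ^ Suc m * weight d p n"
proof -
  have d: "8 ^ Suc p \<le> d"
    using power_increasing[of "Suc p" "Suc m" "8::nat"] assms by linarith
  have "weight d (Suc p) n \<le> 2 ^ Suc m * walk_poly d [:1, - r:] (weight d p) n" for n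
  proof -
    have "weight d (Suc p) n = 2 ^ Suc p * (weight d (Suc p) n / 2 ^ Suc p)"
      by simp
    also have "\<dots> \<le> 2 ^ Suc m * (weight d p n - walk d (weight d p) n)"
    proof (intro mult_mono)
      show "(2::real) ^ Suc p \<le> 2 ^ Suc m"
        using assms(2) by (intro power_increasing) auto
    qed (use walk_weight_le[OF assms(1) d, of n] weight_pos[of d "Suc p" n] in auto)
    also have "\<dots> \<le> 2 ^ Suc m * (weight d p n - r * walk d (weight d p) n)"
      using assms(4,5) walk_nonneg[of "weight d p" d n] weight_pos[of d p]
      by (intro mult_left_mono diff_left_mono) (auto simp: less_imp_le intro!: mult_left_le_one_le)
    also have "weight d p n - r * walk d (weight d p) n = walk_poly d [:1, - r:] (weight d p) n"
      using walk_linear[of d "- r" "weight d p" 0 "weight d p" n] by simp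
    finally show ?thesis .
  qed
  then have "0 \<le> walk_poly d (neumann r L ^ 1)
      (\<lambda>n. 2 ^ Suc m * walk_poly d [:1, - r:] (weight d p) n + (- 1) * weight d (Suc p) n) n"
    by (intro neumann_pow_nonneg assms(4)) simp
  then have "walk_poly d (neumann r L) (weight d (Suc p)) n \<le>
      2 ^ Suc m * walk_poly d (neumann r L) (walk_poly d [:1, - r:] (weight d p)) n"
    unfolding walk_poly_linear by (simp del: walk_poly_pCons)
  also have "walk_poly d (neumann r L) (walk_poly d [:1, - r:] (weight d p)) n =
      weight d p n - walk_poly d ([:0, r:] ^ L) (weight d p) n"
    using one_minus_mult_neumann[of r L] by (simp only: mult.commute walk_poly_diff walk_poly_1 flip: walk_poly_mult)
  also have "2 ^ Suc m * \<dots> \<le> 2 ^ Suc m * weight d p n"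
    using walk_poly_pow_X_nonneg[of r "weight d p" d L n] assms(4) weight_pos[of d p]
    by (intro mult_left_mono) (auto simp: less_imp_le)
  finally show ?thesis .
qed

text \<open>Each inversion lowers the exponent by one and must land on an exponent
  \<open>p \<ge> 1\<close>; hence \<open>m\<close> inversions start from
  \<open>Suc m\<close>.\<close>

lemma neumann_pow_weight_le:
  assumes "i \<le> m" "8 ^ Suc m \<le> d" "0 \<le> r" "r < 1"
  shows "walk_poly d (neumann r L ^ i) (weight d (Suc m)) n \<le> (2 ^ Suc m) ^ i * weight d (Suc m - i) n"
  using assms(1)
proof (induction i arbitrary: n)
  case (Suc i)
  define c :: real where "c = (2 ^ Suc m) ^ i"
  have "0 \<le> walk_poly d (neumann r L ^ 1)
      (\<lambda>n. c * weight d (Suc m - i) n + (- 1) * walk_poly d (neumann r L ^ i) (weight d (Suc m)) n) n"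
    using Suc by (intro neumann_pow_nonneg assms(3)) (simp add: c_def)
  then have "walk_poly d (neumann r L ^ Suc i) (weight d (Suc m)) n \<le>
      c * walk_poly d (neumann r L) (weight d (Suc (m - i))) n"
    using Suc.prems unfolding walk_poly_linear by (simp add: walk_poly_mult Suc_diff_le)
  also have "\<dots> \<le> c * (2 ^ Suc m * weight d (m - i) n)"
    using Suc.prems assms by (intro mult_left_mono neumann_weight_le) (auto simp: c_def)
  finally show ?case
    by (simp add: c_def mult_ac)
qed simp

section \<open>The inequality for real-valued functions\<close>

lemma real_hardy_rellich:
  fixes k d :: nat
  defines "m \<equiv> 2 * k + 1"
  assumes u: "finsupp d u" "u (\<lambda>_. 0) = 0" and d: "8 ^ Suc m \<le> d"
  shows "(real d / 2 ^ Suc m) ^ m * lsum d (\<lambda>n. (u n)\<^sup>2 / norm_sq d n ^ m) \<le>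
    lsum d (\<lambda>n. u n * walk_poly d ([:2 * real d, - (2 * real d):] ^ m) u n)"
proof -
  define c :: real where "c = (2 ^ Suc m) ^ m"
  define W where "W = (\<lambda>n. c * (1 + norm_sq d n) ^ m)"
  have "c > 0" by (simp add: c_def)
  have "(0::nat) < 8 ^ Suc m" by simp
  with d have "d > 0" by linarith
  have poly: "[:2 * real d, - (2 * real d):] ^ m = smult ((2 * real d) ^ m) ([:1, - 1:] ^ m)"
  proof -
    have "[:2 * real d, - (2 * real d):] = smult (2 * real d) [:1, - 1:]"
      by simp
    then show ?thesis by (simp only: smult_power)
  qed
  have "(real d / 2 ^ Suc m) ^ m * lsum d (\<lambda>n. (u n)\<^sup>2 / norm_sq d n ^ m) =
      lsum d (\<lambda>n. (real d / 2 ^ Suc m) ^ m * ((u n)\<^sup>2 / norm_sq d n ^ m))"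
    by (simp only: infsum_cmult_right')
  also have "\<dots> \<le> lsum d (\<lambda>n. (2 * real d) ^ m * ((u n)\<^sup>2 / W n))"
  proof (rule lsum_mono)
    fix n assume n: "n \<in> lattice d"
    show "(real d / 2 ^ Suc m) ^ m * ((u n)\<^sup>2 / norm_sq d n ^ m) \<le> (2 * real d) ^ m * ((u n)\<^sup>2 / W n)"
    proof (cases "n = (\<lambda>_. 0)")
      case False
      then obtain i where "n i \<noteq> 0" by auto
      with n have "i < d" by (auto simp: lattice_def not_less[symmetric])
      have "0 < (n i)\<^sup>2" using \<open>n i \<noteq> 0\<close> by simp
      then have "1 \<le> (n i)\<^sup>2" by linarith
      then have "1 \<le> (real_of_int (n i))\<^sup>2"
        by (metis of_int_1_le_iff of_int_power)
      also have "\<dots> \<le> norm_sq d n"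
        unfolding norm_sq_def using \<open>i < d\<close> by (intro member_le_sum) auto
      finally have *: "1 \<le> norm_sq d n" .
      \<comment> \<open>Away from the origin \<open>1 + norm_sq d n \<le> 2 * norm_sq d n\<close>;
        the resulting loss \<open>2 ^ m\<close> cancels against the \<open>2 ^ m\<close> in
        \<open>(2 * real d) ^ m\<close>.\<close>
      then have "(1 + norm_sq d n) ^ m \<le> (2 * norm_sq d n) ^ m"
        by (intro power_mono) auto
      then have "W n \<le> c * (2 * norm_sq d n) ^ m"
        using \<open>c > 0\<close> by (simp add: W_def)
      moreover have "0 < W n"
        using \<open>c > 0\<close> * by (simp add: W_def)
      ultimately have "(2 * real d) ^ m * (u n)\<^sup>2 / (c * (2 * norm_sq d n) ^ m) \<le> (2 * real d) ^ m * (u n)\<^sup>2 / W n"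
        by (intro divide_left_mono mult_pos_pos) (use * \<open>c > 0\<close> in auto)
      moreover have "(a / b) ^ m * (x / z ^ m) = (2 * a) ^ m * x / (b ^ m * (2 * z) ^ m)" for a b x z :: real
        by (simp add: power_mult_distrib power_divide)
      ultimately show ?thesis
        unfolding c_def by (simp only: times_divide_eq_right)
    qed (use u in simp)
  qed (auto intro: finsupp_mono[OF u(1)])
  also have "\<dots> = (2 * real d) ^ m * lsum d (\<lambda>n. (u n)\<^sup>2 / W n)"
    by (simp only: infsum_cmult_right')
  also have "\<dots> \<le> (2 * real d) ^ m * lsum d (\<lambda>n. u n * walk_poly d ([:1, - 1:] ^ m) u n)"
  proof (rule mult_left_mono)
    show "lsum d (\<lambda>n. (u n)\<^sup>2 / W n) \<le> lsum d (\<lambda>n. u n * walk_poly d ([:1, - 1:] ^ m) u n)"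
      unfolding m_def
    proof (rule undamped_lower_bound[where \<phi> = "weight d (Suc m)"])
      fix r L n assume r: "0 \<le> r" "r < (1::real)"
      have "walk_poly d (neumann r L ^ m) (weight d (Suc m)) n \<le> c * weight d (Suc m - m) n"
        unfolding c_def using d r by (intro neumann_pow_weight_le) auto
      also have "\<dots> = W n * weight d (Suc m) n"
        using norm_sq_nonneg[of d n] by (simp add: W_def weight_def)
      finally show "walk_poly d (neumann r L ^ (2 * k + 1)) (weight d (Suc m)) n \<le> W n * weight d (Suc m) n"
        by (simp add: m_def)
    next
      show "W n > 0" for n
        using \<open>c > 0\<close> by (simp add: W_def add_pos_nonneg)
    qed (use u \<open>d > 0\<close> weight_pos in auto)
  qed simp
  also have "\<dots> = lsum d (\<lambda>n. u n * walk_poly d ([:2 * real d, - (2 * real d):] ^ m) u n)"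
    by (simp add: poly walk_poly_smult mult.left_commute flip: infsum_cmult_right')
  finally show ?thesis .
qed

section \<open>The sharp constant\<close>

text \<open>Used with \<open>Re\<close> and \<open>Im\<close> as \<open>h\<close>, this reduces the
  complex problem to the real calculus of \<open>walk_poly\<close>.\<close>

lemma linear_laplacian_pow:
  fixes h :: "complex \<Rightarrow> real"
  assumes "linear h" "d > 0"
  shows "h ((laplacian d ^^ k) u n) = walk_poly d ([:2 * real d, - (2 * real d):] ^ k) (\<lambda>n. h (u n)) n"
proof (induction k arbitrary: n)
  case (Suc k)
  define v where "v = (laplacian d ^^ k) u"
  have "h (2 * z) = 2 * h z" for z
    using linear_add[OF assms(1), of z z] by simp
  then have "h ((laplacian d ^^ Suc k) u n) =
      (\<Sum>j<d. 2 * h (v n) - h (v (shift j (- 1) n)) - h (v (shift j 1 n)))"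
    using assms(1) by (simp add: laplacian_def shift_def linear_sum linear_diff flip: v_def)
  also have "\<dots> = walk_poly d [:2 * real d, - (2 * real d):] (\<lambda>n. h (v n)) n"
    by (rule walk_poly_laplacian[OF assms(2), symmetric])
  also have "(\<lambda>n. h (v n)) = walk_poly d ([:2 * real d, - (2 * real d):] ^ k) (\<lambda>n. h (u n))"
    using Suc by (auto simp: v_def)
  finally show ?case
    by (simp only: power_Suc walk_poly_mult)
qed simp

definition energy :: "nat \<Rightarrow> nat \<Rightarrow> ((nat \<Rightarrow> int) \<Rightarrow> real) \<Rightarrow> real" where
  "energy k d f = lsum d (\<lambda>n. f n * walk_poly d ([:2 * real d, - (2 * real d):] ^ (2 * k + 1)) f n)"

lemma lsum_grad_norm_sq:
  assumes "finitely_supported d u" "d > 0"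
  shows "lsum d (grad_norm_sq d ((laplacian d ^^ k) u)) =
    energy k d (\<lambda>n. Re (u n)) + energy k d (\<lambda>n. Im (u n))"
proof -
  define P where "P = [:2 * real d, - (2 * real d):]"
  define D where "D = (\<lambda>f n. \<Sum>j<d. (f n - f (shift j (- 1) n :: nat \<Rightarrow> int))\<^sup>2 :: real)"
  have fin: "finsupp d (\<lambda>n. h (u n))" if "linear h" for h
    using assms(1) unfolding finsupp_def finitely_supported_def
    by (rule finite_subset[rotated]) (use linear_0[OF that] in auto)
  have fin': "finsupp d (D f)" if "finsupp d f" for f
    unfolding D_def power2_eq_square
    by (intro finsupp_sum finsupp_mult finsupp_diff finsupp_shift that) auto
  have energy: "energy k d f = lsum d (D (walk_poly d (P ^ k) f))" if "finsupp d f" for f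
    unfolding energy_def P_def[symmetric] lsum_odd_pow[OF that]
    using dirichlet_form[OF finsupp_walk_poly[OF that] assms(2)] by (simp add: P_def D_def)
  have "grad_norm_sq d w = (\<lambda>n. D (\<lambda>n. Re (w n)) n + D (\<lambda>n. Im (w n)) n)" for w
    by (rule ext) (simp add: grad_norm_sq_def backward_diff_def D_def shift_def cmod_power2 sum.distrib)
  then have "lsum d (grad_norm_sq d ((laplacian d ^^ k) u)) =
      lsum d (\<lambda>n. D (walk_poly d (P ^ k) (\<lambda>n. Re (u n))) n + D (walk_poly d (P ^ k) (\<lambda>n. Im (u n))) n)"
    using assms(2)
    by (simp only: linear_laplacian_pow[OF bounded_linear.linear[OF bounded_linear_Re]]
        linear_laplacian_pow[OF bounded_linear.linear[OF bounded_linear_Im]] P_def)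
  also have "\<dots> = energy k d (\<lambda>n. Re (u n)) + energy k d (\<lambda>n. Im (u n))"
    using fin[OF bounded_linear.linear[OF bounded_linear_Re]] fin[OF bounded_linear.linear[OF bounded_linear_Im]]
    by (simp only: energy lsum_add fin' finsupp_walk_poly)
  finally show ?thesis .
qed

lemma lattice_norm_power: "lattice_norm d n ^ (4 * k + 2) = norm_sq d n ^ (2 * k + 1)"
proof -
  have "lattice_norm d n ^ (2 * (2 * k + 1)) = norm_sq d n ^ (2 * k + 1)"
    by (simp only: power_mult lattice_norm_def norm_sq_def L2_set_def real_sqrt_pow2 sum_nonneg zero_le_power2)
  then show ?thesis by (simp only: distrib_left mult.assoc[symmetric]) simp
qed

lemma hardy_rellich_lower:
  fixes k d :: nat
  assumes "8 ^ (2 * k + 2) \<le> d"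
  shows "hardy_rellich_ineq k d ((real d / 2 ^ (2 * k + 2)) ^ (2 * k + 1))"
  unfolding hardy_rellich_ineq_def
proof (intro allI impI; elim conjE)
  fix u assume u: "finitely_supported d u" "u (\<lambda>_. 0) = 0"
  define C where "C = (real d / 2 ^ (2 * k + 2)) ^ (2 * k + 1)"
  have "(0::nat) < 8 ^ (2 * k + 2)" by simp
  with assms have d: "d > 0" by linarith
  have fin: "finsupp d (\<lambda>n. Re (u n))" "finsupp d (\<lambda>n. Im (u n))"
    using u(1) unfolding finsupp_def finitely_supported_def
    by (auto elim!: finite_subset[rotated])
  have "C * lsum d (\<lambda>n. (cmod (u n))\<^sup>2 / lattice_norm d n ^ (4 * k + 2)) =
      C * lsum d (\<lambda>n. (Re (u n))\<^sup>2 / norm_sq d n ^ (2 * k + 1) + (Im (u n))\<^sup>2 / norm_sq d n ^ (2 * k + 1))"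
    by (simp only: lattice_norm_power cmod_power2 add_divide_distrib)
  also have "\<dots> = C * lsum d (\<lambda>n. (Re (u n))\<^sup>2 / norm_sq d n ^ (2 * k + 1)) +
      C * lsum d (\<lambda>n. (Im (u n))\<^sup>2 / norm_sq d n ^ (2 * k + 1))"
    by (subst lsum_add) (auto simp: distrib_left intro: finsupp_mono[OF fin(1)] finsupp_mono[OF fin(2)])
  also have "\<dots> \<le> energy k d (\<lambda>n. Re (u n)) + energy k d (\<lambda>n. Im (u n))"
    using real_hardy_rellich[OF fin(1), of k] real_hardy_rellich[OF fin(2), of k] u(2) assms
    by (simp add: C_def energy_def add_mono)
  also have "\<dots> = lsum d (grad_norm_sq d ((laplacian d ^^ k) u))"
    by (rule lsum_grad_norm_sq[OF u(1) d, symmetric])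
  finally show "lsum d (grad_norm_sq d ((laplacian d ^^ k) u)) \<ge>
      (real d / 2 ^ (2 * k + 2)) ^ (2 * k + 1) * lsum d (\<lambda>n. (cmod (u n))\<^sup>2 / lattice_norm d n ^ (4 * k + 2))"
    unfolding C_def .
qed

section \<open>The upper bound from a unit mass\<close>

lemma abs_walk_poly_laplacian_pow_le:
  assumes "d > 0" "\<And>n. n \<in> lattice d \<Longrightarrow> \<bar>f n\<bar> \<le> M" "n \<in> lattice d"
  shows "\<bar>walk_poly d ([:2 * real d, - (2 * real d):] ^ m) f n\<bar> \<le> (4 * real d) ^ m * M"
  using assms(3)
proof (induction m arbitrary: n)
  case (Suc m)
  define g where "g = walk_poly d ([:2 * real d, - (2 * real d):] ^ m) f"
  define N where "N = (4 * real d) ^ m * M"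
  have g: "\<bar>g n\<bar> \<le> N" if "n \<in> lattice d" for n
    using Suc.IH[OF that] by (simp add: g_def N_def)
  have "\<bar>\<Sum>j<d. 2 * g n - g (shift j (- 1) n) - g (shift j 1 n)\<bar> \<le> (\<Sum>j<d. 4 * N)"
  proof (rule order.trans[OF sum_abs sum_mono])
    show "\<bar>2 * g n - g (shift j (- 1) n) - g (shift j 1 n)\<bar> \<le> 4 * N" if "j \<in> {..<d}" for j
      using g[OF shift_lattice[of j d n "- 1"]] g[OF shift_lattice[of j d n 1]] g[OF Suc.prems] Suc.prems that
      by simp
  qed
  then show ?case
    by (simp only: power_Suc walk_poly_mult walk_poly_laplacian[OF assms(1)] g_def[symmetric]) (simp add: N_def)
qed (use assms(2) in simp)

lemma hardy_rellich_upper: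
  assumes "d > 0" "hardy_rellich_ineq k d C"
  shows "C \<le> (4 * real d) ^ (2 * k + 1)"
proof -
  define e :: "nat \<Rightarrow> int" where "e = (\<lambda>_. 0)(0 := 1)"
  define u :: "(nat \<Rightarrow> int) \<Rightarrow> complex" where "u = (\<lambda>n. if n = e then 1 else 0)"
  have e: "e \<in> lattice d"
    using assms(1) by (auto simp: e_def lattice_def)
  have "e \<noteq> (\<lambda>_. 0)"
    by (auto simp: e_def fun_eq_iff)
  then have u0: "u (\<lambda>_. 0) = 0"
    by (auto simp: u_def)
  have fin: "finitely_supported d u"
    unfolding finitely_supported_def by (rule finite_subset[of _ "{e}"]) (auto simp: u_def)
  have "norm_sq d e = norm_sq d (shift 0 1 (\<lambda>_. 0))"
    by (simp add: e_def shift_def)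
  also have "\<dots> = 1"
    using assms(1) by (simp add: norm_sq_shift) (simp add: norm_sq_def)
  finally have norm: "norm_sq d e = 1" .
  have "lsum d (\<lambda>n. (cmod (u n))\<^sup>2 / lattice_norm d n ^ (4 * k + 2)) =
      (\<Sum>n\<in>{e}. (cmod (u n))\<^sup>2 / lattice_norm d n ^ (4 * k + 2))"
    by (rule lsum_eq_sum) (use e in \<open>auto simp: u_def\<close>)
  also have "\<dots> = 1"
    unfolding lattice_norm_power by (simp add: u_def norm)
  finally have "C = C * lsum d (\<lambda>n. (cmod (u n))\<^sup>2 / lattice_norm d n ^ (4 * k + 2))"
    by simp
  also have "\<dots> \<le> lsum d (grad_norm_sq d ((laplacian d ^^ k) u))"
    using assms(2) fin u0 unfolding hardy_rellich_ineq_def by blast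
  also have "\<dots> = energy k d (\<lambda>n. Re (u n)) + energy k d (\<lambda>n. Im (u n))"
    by (rule lsum_grad_norm_sq[OF fin assms(1)])
  also have "(\<lambda>n. Im (u n)) = (\<lambda>_. 0)"
    by (auto simp: u_def)
  also have "energy k d (\<lambda>_. 0) = 0"
    by (simp add: energy_def)
  also have "energy k d (\<lambda>n. Re (u n)) =
      (\<Sum>n\<in>{e}. Re (u n) * walk_poly d ([:2 * real d, - (2 * real d):] ^ (2 * k + 1)) (\<lambda>n. Re (u n)) n)"
    unfolding energy_def by (rule lsum_eq_sum) (use e in \<open>auto simp: u_def\<close>)
  also have "\<dots> = walk_poly d ([:2 * real d, - (2 * real d):] ^ (2 * k + 1)) (\<lambda>n. Re (u n)) e"
    by (simp only: sum.insert finite.emptyI sum.empty empty_iff not_False_eq_True) (simp add: u_def)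
  also have "\<dots> \<le> \<bar>\<dots>\<bar>"
    by (rule abs_ge_self)
  also have "\<dots> \<le> (4 * real d) ^ (2 * k + 1) * 1"
    by (rule abs_walk_poly_laplacian_pow_le[OF assms(1) _ e]) (simp add: u_def)
  finally show ?thesis by simp
qed

theorem theorem3p2:
  fixes k :: nat
  shows "\<exists>c\<^sub>1 c\<^sub>2 :: real. \<exists>N :: nat. c\<^sub>1 > 0 \<and> c\<^sub>2 > 0 \<and> N > 0 \<and>
    (\<forall>d\<ge>N. c\<^sub>1 * real d ^ (2 * k + 1) \<le> sharp_constant k d \<and>
            sharp_constant k d \<le> c\<^sub>2 * real d ^ (2 * k + 1))"
proof (intro exI conjI allI impI)
  \<comment> \<open>With \<open>m = 2 * k + 1\<close>, the witnesses are the factor of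
    \<open>d ^ m\<close> in the lower bound, \<open>4 ^ m\<close> from the unit mass, and the
    threshold \<open>N = 8 ^ (m + 1)\<close> of the weight estimate.\<close>
  show "(0::real) < 1 / (2 ^ (2 * k + 2)) ^ (2 * k + 1)" "(0::real) < 4 ^ (2 * k + 1)"
    and N: "(0::nat) < 8 ^ (2 * k + 2)"
    by simp_all
  fix d :: nat assume d: "8 ^ (2 * k + 2) \<le> d"
  with N have "d \<ge> 1" by linarith
  show "1 / (2 ^ (2 * k + 2)) ^ (2 * k + 1) * real d ^ (2 * k + 1) \<le> sharp_constant k d"
    using sharp_constant_greatest(2)[OF \<open>d \<ge> 1\<close> hardy_rellich_lower[OF d]] by (simp add: power_divide)
  show "sharp_constant k d \<le> 4 ^ (2 * k + 1) * real d ^ (2 * k + 1)"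
    unfolding power_mult_distrib[symmetric]
    by (rule hardy_rellich_upper[OF _ sharp_constant_greatest(1)]) (use \<open>d \<ge> 1\<close> in simp_all)
qed

end
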